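(* Alexander lattices of cyclically ordered quivers are invariant under wiggles and proper mutations. That is, if a cyclically ordered quiver $(Q',\sigma')$ on $n$ vertices is obtained from $(Q,\sigma)$ by a wiggle or by a proper mutation at a proper vertex, then for every $k\in\{1,\dots,n\}$ the $k$-th Alexander lattices of $(Q,\sigma)$ and $(Q',\sigma')$ coincide as subgroups of $\mathbb Z[t]$.
   Context: A quiver is a finite directed graph without loops or oriented 2-cycles; multiple arrows are allowed. Mutation $\mu_j$ of a quiver at a vertex $j$: for each path $i\to j\to k$ add an arrow $i\to k$; reverse all arrows incident to $j$; repeatedly remove oriented 2-cycles. A cyclic ordering $\sigma=(v_1,\dots,v_n)$ of the vertex set is a linear ordering $v_1<\dots<v_n$ considered up to cyclic shifts ("clockwise" placement on a circle); the $n$ linear orderings in this class are called compatible with $\sigma$. A cyclically ordered quiver (COQ) $(Q,\sigma)$ is a quiver with a cyclic ordering of its vertices. A wiggle transforms $(Q,\sigma)$ into $(Q,\sigma')$ where $\sigma'$ is obtained from $\sigma$ by interchanging two vertices that are consecutive in $\sigma$ and not adjacent in $Q$. A path $i\to j\to k$ in $Q$ makes a right turn at $j$ if $\sigma=(\dots,i,\dots,j,\dots,k,\dots)$. A vertex $j$ is proper in $(Q,\sigma)$ if every oriented two-arrow path $i\to j\to k$ in $Q$ makes a right turn at $j$. Let $\operatorname{In}(j)$ (resp., $\operatorname{Out}(j)$) be the set of vertices $i$ with an arrow $i\to j$ (resp., $j\to i$) in $Q$. If $j$ is proper, the proper mutation $\mu_j(Q,\sigma)$ is the quiver $\mu_j(Q)$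 with the cyclic ordering obtained from $\sigma$ by keeping the placement of all vertices other than $j$ and moving $j$ clockwise past all the vertices in $\operatorname{Out}(j)$ (each exactly once) without passing any vertex in $\operatorname{In}(j)$. This placement is well defined up to wiggles of the mutated COQ; for a sink or source $j$ the cyclic ordering does not change (up to wiggles). Given a linear ordering $v_1<\dots<v_n$ of the vertices, the exchange matrix $B=(b_{ij})$ is the skew-symmetric integer matrix with $b_{ij}=x$ if $Q$ contains $x\ge0$ arrows $v_i\to v_j$ and $b_{ij}=-x$ if $Q$ contains $x\ge 0$ arrows $v_j\to v_i$. The unipotent companion $U_Q$ is the unique unipotent upper-triangular matrix $U$ with $-B=U-U^T$. The parametrized companion is the matrix $P_Q(t)=tU_Q-U_Q^T$ with entries in $\mathbb Z[t]$. For $1\le k\le n$, the $k$-th Alexander lattice is the $\mathbb Z$-span in $\mathbb Z[t]$ of all $k\times k$ minors of $P_Q(t)$. For a COQ $(Q,\sigma)$ it is computed using any linear ordering compatible with $\sigma$ (the result does not depend on this choice). *)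

theory Defs
  imports
    "Jordan_Normal_Form.DL_Submatrix"
    "Jordan_Normal_Form.Determinant"
    "HOL-Library.Sublist"
begin

section \<open>Quivers and mutation\<close>

text \<open>
  Arrows are recorded by their multiplicities: \<open>arrows Q i j\<close> is the number of arrows
  \<open>i \<rightarrow> j\<close>.
\<close>

record 'a quiver =
  verts :: "'a set"
  arrows :: "'a \<Rightarrow> 'a \<Rightarrow> nat"

definition wf_quiver :: "'a quiver \<Rightarrow> bool" where
  "wf_quiver Q \<longleftrightarrow>
     finite (verts Q) \<and>
     (\<forall>i j. arrows Q i j > 0 \<longrightarrow> i \<in> verts Q \<and> j \<in> verts Q) \<and>
     (\<forall>i. arrows Q i i = 0) \<and>
     (\<forall>i j. arrows Q i j = 0 \<or> arrows Q j i = 0)"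

definition In_set :: "'a quiver \<Rightarrow> 'a \<Rightarrow> 'a set" where
  "In_set Q j = {i. arrows Q i j > 0}"

definition Out_set :: "'a quiver \<Rightarrow> 'a \<Rightarrow> 'a set" where
  "Out_set Q j = {i. arrows Q j i > 0}"

definition compose_paths_at ::
  "'a \<Rightarrow> ('a \<Rightarrow> 'a \<Rightarrow> nat) \<Rightarrow> 'a \<Rightarrow> 'a \<Rightarrow> nat" where
  "compose_paths_at j q = (\<lambda>i k. q i k + q i j * q j k)"

definition reverse_arrows_at ::
  "'a \<Rightarrow> ('a \<Rightarrow> 'a \<Rightarrow> nat) \<Rightarrow> 'a \<Rightarrow> 'a \<Rightarrow> nat" where
  "reverse_arrows_at j q = (\<lambda>i k. if i = j \<or> k = j then q k i else q i k)"

text \<open>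
  Removing oriented 2-cycles as long as possible deletes \<open>min (q i k) (q k i)\<close> arrows in each
  direction; the truncated subtraction of natural numbers gives what is left.
\<close>

definition cancel_two_cycles ::
  "('a \<Rightarrow> 'a \<Rightarrow> nat) \<Rightarrow> 'a \<Rightarrow> 'a \<Rightarrow> nat" where
  "cancel_two_cycles q = (\<lambda>i k. q i k - q k i)"

definition mutate :: "'a \<Rightarrow> 'a quiver \<Rightarrow> 'a quiver" where
  "mutate j Q =
     Q\<lparr>arrows := cancel_two_cycles (reverse_arrows_at j (compose_paths_at j (arrows Q)))\<rparr>"

lemma wf_quiver_mutate:
  assumes "wf_quiver Q"
  shows "wf_quiver (mutate j Q)"
  using assms
  unfolding wf_quiver_def mutate_def cancel_two_cycles_def reverse_arrows_at_def
    compose_paths_at_def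
  by (auto split: if_splits) (metis add_is_0 gr0I mult_is_0)+


section \<open>Cyclically ordered quivers\<close>

text \<open>
  A linear ordering is a duplicate-free list of the vertices. A cyclic ordering is the set of
  all linear orderings compatible with it, that is, a class of lists up to rotation.
\<close>

definition cyclic_class :: "'a list \<Rightarrow> 'a list set" where
  "cyclic_class l = {rotate m l |m. True}"

definition cyclic_ordering_on :: "'a set \<Rightarrow> 'a list set \<Rightarrow> bool" where
  "cyclic_ordering_on V \<sigma> \<longleftrightarrow> (\<exists>l. distinct l \<and> set l = V \<and> \<sigma> = cyclic_class l)"

type_synonym 'a coq = "'a quiver \<times> 'a list set"

definition wf_coq :: "'a coq \<Rightarrow> bool" where
  "wf_coq = (\<lambda>(Q, \<sigma>). wf_quiver Q \<and> cyclic_ordering_on (verts Q) \<sigma>)"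

text \<open>
  Since \<open>\<sigma>\<close> is a class up to rotation, two consecutive vertices can always be
  rotated to the front of a list.
\<close>

definition wiggle :: "'a coq \<Rightarrow> 'a coq \<Rightarrow> bool" where
  "wiggle = (\<lambda>(Q, \<sigma>) (Q', \<sigma>').
     Q' = Q \<and>
     (\<exists>a b xs. \<sigma> = cyclic_class (a # b # xs) \<and> \<sigma>' = cyclic_class (b # a # xs) \<and>
               arrows Q a b = 0 \<and> arrows Q b a = 0))"

definition right_turn :: "'a list set \<Rightarrow> 'a \<Rightarrow> 'a \<Rightarrow> 'a \<Rightarrow> bool" where
  "right_turn \<sigma> i j k \<longleftrightarrow> (\<exists>l\<in>\<sigma>. subseq [i, j, k] l)"

definition proper_vertex :: "'a coq \<Rightarrow> 'a \<Rightarrow> bool" where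
  "proper_vertex = (\<lambda>(Q, \<sigma>) j.
     j \<in> verts Q \<and>
     (\<forall>i k. arrows Q i j > 0 \<and> arrows Q j k > 0 \<longrightarrow> right_turn \<sigma> i j k))"

text \<open>
  The new position of \<open>j\<close> is determined only up to wiggles of the mutated quiver, so proper
  mutation is a relation that admits every allowed position. Here \<open>xs\<close> are the vertices that
  \<open>j\<close> passes while moving clockwise, each of them once.
\<close>

definition proper_mutation :: "'a \<Rightarrow> 'a coq \<Rightarrow> 'a coq \<Rightarrow> bool" where
  "proper_mutation j = (\<lambda>(Q, \<sigma>) (Q', \<sigma>').
     proper_vertex (Q, \<sigma>) j \<and>
     Q' = mutate j Q \<and>
     (\<exists>xs ys. \<sigma> = cyclic_class (j # xs @ ys) \<and> \<sigma>' = cyclic_class (xs @ j # ys) \<and>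
              Out_set Q j \<subseteq> set xs \<and> In_set Q j \<inter> set xs = {}))"

text \<open>Both moves preserve well-formedness, and every proper vertex can be mutated.\<close>

lemma cyclic_class_append: "cyclic_class (xs @ ys) = cyclic_class (ys @ xs)"
proof -
  have sub: "cyclic_class (bs @ us) \<subseteq> cyclic_class (us @ bs)" for us bs :: "'a list"
  proof -
    have "rotate m (bs @ us) = rotate (m + length us) (us @ bs)" for m
      by (simp only: rotate_rotate[symmetric] rotate_append)
    then show ?thesis by (auto simp: cyclic_class_def)
  qed
  show ?thesis using sub[of ys xs] sub[of xs ys] by blast
qed

lemma distinct_set_cyclic_class:
  "l' \<in> cyclic_class l \<Longrightarrow> distinct l' = distinct l \<and> set l' = set l"
  unfolding cyclic_class_def by fastforce

lemma self_in_cyclic_class: "l \<in> cyclic_class l"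
proof -
  have "l = rotate 0 l" by simp
  then show ?thesis unfolding cyclic_class_def by blast
qed

lemma wf_coq_cyclic_class:
  "wf_coq (Q, cyclic_class l) \<longleftrightarrow> wf_quiver Q \<and> distinct l \<and> set l = verts Q"
proof -
  have "l \<in> cyclic_class l'" if "cyclic_class l = cyclic_class l'" for l'
    using self_in_cyclic_class[of l] that by simp
  then have "distinct l \<and> set l = V" if "cyclic_ordering_on V (cyclic_class l)" for V
    using that distinct_set_cyclic_class unfolding cyclic_ordering_on_def by metis
  moreover have "cyclic_ordering_on V (cyclic_class l)" if "distinct l" "set l = V" for V
    using that unfolding cyclic_ordering_on_def by blast
  ultimately show ?thesis unfolding wf_coq_def prod.case by blast
qed

lemma wf_coq_wiggle:
  assumes "wf_coq (Q, \<sigma>)" "wiggle (Q, \<sigma>) (Q', \<sigma>')"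
  shows "wf_coq (Q', \<sigma>')"
proof -
  obtain a b xs where "Q' = Q" "\<sigma> = cyclic_class (a # b # xs)" "\<sigma>' = cyclic_class (b # a # xs)"
    using assms(2) by (auto simp: wiggle_def)
  then show ?thesis using assms(1) by (auto simp: wf_coq_cyclic_class)
qed

lemma wf_coq_proper_mutation:
  assumes "wf_coq (Q, \<sigma>)" "proper_mutation j (Q, \<sigma>) (Q', \<sigma>')"
  shows "wf_coq (Q', \<sigma>')"
proof -
  obtain xs ys where "Q' = mutate j Q" "\<sigma> = cyclic_class (j # xs @ ys)"
    "\<sigma>' = cyclic_class (xs @ j # ys)"
    using assms(2) by (auto simp: proper_mutation_def)
  then show ?thesis using assms(1)
    by (auto simp: wf_coq_cyclic_class wf_quiver_mutate) (auto simp: mutate_def)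
qed

lemma filter_rotate: "\<exists>m'. filter P (rotate m l) = rotate m' (filter P l)"
proof (induction m)
  case 0
  have "filter P (rotate 0 l) = rotate 0 (filter P l)" by simp
  then show ?case ..
next
  case (Suc m)
  then obtain m' where m': "filter P (rotate m l) = rotate m' (filter P l)" by blast
  show ?case
  proof (cases "rotate m l")
    case Nil
    then show ?thesis using m' by (metis rotate_Suc rotate1.simps(1))
  next
    case (Cons x xs)
    have suc: "filter P (rotate (Suc m) l) = filter P xs @ filter P [x]"
      using Cons by simp
    have m'': "filter P [x] @ filter P xs = rotate m' (filter P l)"
      using m' unfolding Cons by (simp split: if_splits)
    have "filter P (rotate (Suc m) l) = rotate (if P x then Suc m' else m') (filter P l)"
    proof (cases "P x")
      case True
      have "rotate (Suc m') (filter P l) = rotate1 (filter P [x] @ filter P xs)"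
        unfolding m'' by simp
      then show ?thesis unfolding suc using True by simp
    next
      case False
      then show ?thesis unfolding suc using m'' by simp
    qed
    then show ?thesis ..
  qed
qed

lemma filter_subseq_distinct:
  assumes "subseq s l" "distinct l"
  shows "filter (\<lambda>x. x \<in> set s) l = s"
  using assms
proof (induction rule: list_emb.induct)
  case (list_emb_Nil ys)
  then show ?case by simp
next
  case (list_emb_Cons xs ys y)
  have "set xs \<subseteq> set ys"
    using list_emb_set[OF list_emb_Cons.hyps(1)] by blast
  then have "y \<notin> set xs" using list_emb_Cons.prems by auto
  then show ?case using list_emb_Cons.IH list_emb_Cons.prems by simp
next
  case (list_emb_Cons2 x y xs ys)
  then have "filter (\<lambda>z. z \<in> set (x # xs)) ys = filter (\<lambda>z. z \<in> set xs) ys"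
    by (intro filter_cong) auto
  moreover have "filter (\<lambda>z. z \<in> set xs) ys = xs"
    using list_emb_Cons2.IH list_emb_Cons2.prems by simp
  ultimately show ?case using list_emb_Cons2.hyps by simp
qed

lemma proper_mutation_exists:
  assumes wf: "wf_coq (Q, \<sigma>)" and pv: "proper_vertex (Q, \<sigma>) j"
  shows "\<exists>C'. proper_mutation j (Q, \<sigma>) C'"
proof -
  have wfQ: "wf_quiver Q" using wf by (simp add: wf_coq_def)
  obtain l where l: "distinct l" "set l = verts Q" "\<sigma> = cyclic_class l"
    using wf by (auto simp: wf_coq_def cyclic_ordering_on_def)
  have "j \<in> set l" using pv l by (simp add: proper_vertex_def)
  then obtain us bs where l_split: "l = us @ j # bs" by (meson split_list)
  define r where "r = bs @ us"
  have sig: "\<sigma> = cyclic_class (j # r)"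
    using cyclic_class_append[of us "j # bs"] l l_split by (simp add: r_def)
  have dist: "distinct (j # r)" and vs: "verts Q = set (j # r)"
    using l l_split by (auto simp: r_def)
  define xs where "xs = takeWhile (\<lambda>x. x \<notin> In_set Q j) r"
  define ys where "ys = dropWhile (\<lambda>x. x \<notin> In_set Q j) r"
  have r: "r = xs @ ys" by (simp add: xs_def ys_def)
  have "In_set Q j \<inter> set xs = {}" unfolding xs_def by (auto dest: set_takeWhileD)
  moreover have "Out_set Q j \<subseteq> set xs"
  proof
    fix k assume k: "k \<in> Out_set Q j"
    then have "k \<in> verts Q" and "k \<noteq> j"
      using wfQ by (auto simp: Out_set_def wf_quiver_def)
    then have kin: "k \<in> set r" "k \<noteq> j" using vs by auto
    show "k \<in> set xs"
    proof (rule ccontr)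
      assume "k \<notin> set xs"
      then have ky: "k \<in> set ys" using kin r by auto
      then obtain i zs where ys: "ys = i # zs" by (cases ys) auto
      then have i: "i \<in> In_set Q j" using hd_dropWhile[of "\<lambda>x. x \<notin> In_set Q j" r]
        by (auto simp: ys_def)
      have "k \<noteq> i" using i k wfQ unfolding In_set_def Out_set_def wf_quiver_def
        by (metis mem_Collect_eq less_irrefl)
      then have kz: "k \<in> set zs" using ky ys by simp
      obtain l' where l': "l' \<in> \<sigma>" "subseq [i, j, k] l'"
        using pv i k by (auto simp: proper_vertex_def right_turn_def In_set_def Out_set_def)
      have "distinct l'" using l' dist sig distinct_set_cyclic_class by blast
      then have f': "filter (\<lambda>x. x \<in> {i, j, k}) l' = [i, j, k]"
        using filter_subseq_distinct[OF l'(2)] by simp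
      have "subseq [k] zs" using kz by (simp add: subseq_singleton_left)
      then have "subseq [i, k] (xs @ i # zs)"
        by (intro list_emb_append2) simp
      then have "subseq [j, i, k] (j # r)" using r ys by simp
      then have f: "filter (\<lambda>x. x \<in> {i, j, k}) (j # r) = [j, i, k]"
        using filter_subseq_distinct[of "[j, i, k]" "j # r"] dist
          insert_commute[of j i "{k}"] by simp
      obtain m where "l' = rotate m (j # r)" using l' sig by (auto simp: cyclic_class_def)
      then obtain m' where m': "[i, j, k] = rotate m' [j, i, k]"
        using filter_rotate[of "\<lambda>x. x \<in> {i, j, k}" m "j # r"] f f' by metis
      have "rotate m' [j, i, k] = rotate (m' mod 3) [j, i, k]"
        using rotate_conv_mod[of m' "[j, i, k]"] by simp
      moreover have "m' mod 3 = 0 \<or> m' mod 3 = 1 \<or> m' mod 3 = 2" by presburger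
      moreover have "rotate 0 [j, i, k] = [j, i, k]" "rotate 1 [j, i, k] = [i, k, j]"
        "rotate 2 [j, i, k] = [k, j, i]" by (simp_all add: numeral_2_eq_2)
      ultimately have "[i, j, k] \<in> {[j, i, k], [i, k, j], [k, j, i]}"
        using m' by (metis insertCI)
      moreover have "i \<noteq> j" using i wfQ by (auto simp: In_set_def wf_quiver_def)
      ultimately show False using kin \<open>k \<noteq> i\<close> by auto
    qed
  qed
  ultimately have "proper_mutation j (Q, \<sigma>) (mutate j Q, cyclic_class (xs @ j # ys))"
    unfolding proper_mutation_def prod.case using pv sig[unfolded r]
    by (intro conjI exI[of _ xs] exI[of _ ys]) simp_all
  then show ?thesis ..
qed


section \<open>Alexander lattices\<close>

definition exchange_matrix :: "'a quiver \<Rightarrow> 'a list \<Rightarrow> int mat" where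
  "exchange_matrix Q l =
     mat (length l) (length l)
       (\<lambda>(i, j). int (arrows Q (l ! i) (l ! j)) - int (arrows Q (l ! j) (l ! i)))"

definition is_unipotent_companion :: "int mat \<Rightarrow> int mat \<Rightarrow> bool" where
  "is_unipotent_companion B U \<longleftrightarrow>
     U \<in> carrier_mat (dim_row B) (dim_row B) \<and>
     upper_triangular U \<and> (\<forall>i < dim_row B. U $$ (i, i) = 1) \<and>
     - B = U - transpose_mat U"

definition unipotent_companion :: "'a quiver \<Rightarrow> 'a list \<Rightarrow> int mat" where
  "unipotent_companion Q l = (THE U. is_unipotent_companion (exchange_matrix Q l) U)"

lemma is_unipotent_companion_iff:
  "is_unipotent_companion (exchange_matrix Q l) U \<longleftrightarrow>
     U = mat (length l) (length l)
           (\<lambda>(i, j). if i = j then 1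
                     else if i < j then - (exchange_matrix Q l $$ (i, j)) else 0)"
  (is "?P U \<longleftrightarrow> U = ?U")
proof
  assume P: "?P U"
  let ?B = "exchange_matrix Q l" and ?n = "length l"
  have U: "U \<in> carrier_mat ?n ?n" and ut: "upper_triangular U"
    and diag: "\<And>i. i < ?n \<Longrightarrow> U $$ (i, i) = 1" and eq: "- ?B = U - transpose_mat U"
    using P by (auto simp: is_unipotent_companion_def exchange_matrix_def)
  show "U = ?U"
  proof (rule eq_matI)
    fix i j assume "i < dim_row ?U" "j < dim_col ?U"
    hence ij: "i < ?n" "j < ?n" by auto
    have "(- ?B) $$ (i, j) = (U - transpose_mat U) $$ (i, j)" by (simp only: eq)
    hence e: "- (?B $$ (i, j)) = U $$ (i, j) - U $$ (j, i)"
      using ij U by (simp add: exchange_matrix_def)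
    show "U $$ (i, j) = ?U $$ (i, j)"
    proof (cases i j rule: linorder_cases)
      case less
      moreover have "U $$ (j, i) = 0" using ut less ij U by auto
      ultimately show ?thesis using e ij by simp
    next
      case equal
      then show ?thesis using diag ij by simp
    next
      case greater
      moreover have "U $$ (i, j) = 0" using ut greater ij U by auto
      ultimately show ?thesis using ij by simp
    qed
  qed (use U in auto)
next
  assume "U = ?U"
  then show "?P U"
    by (auto simp: is_unipotent_companion_def exchange_matrix_def upper_triangular_def
        intro!: eq_matI)
qed

lemma unipotent_companion_unique:
  "\<exists>!U. is_unipotent_companion (exchange_matrix Q l) U"
  by (simp add: is_unipotent_companion_iff)

text \<open>The indeterminate \<open>t\<close> is \<open>[:0, 1:]\<close>.\<close>

definition parametrized_companion :: "'a quiver \<Rightarrow> 'a list \<Rightarrow> int poly mat" where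
  "parametrized_companion Q l =
     (let U = map_mat (\<lambda>c. [:c:]) (unipotent_companion Q l)
      in [:0, 1:] \<cdot>\<^sub>m U - transpose_mat U)"

definition minors :: "nat \<Rightarrow> 'b :: comm_ring_1 mat \<Rightarrow> 'b set" where
  "minors k A =
     {det (submatrix A I J) |I J.
        I \<subseteq> {..<dim_row A} \<and> J \<subseteq> {..<dim_col A} \<and> card I = k \<and> card J = k}"

text \<open>The \<open>\<int>\<close>-span below is taken in the \<open>\<int>\<close>-module \<open>\<int>[t]\<close>.\<close>

lemma module_smult: "Modules.module (smult :: int \<Rightarrow> int poly \<Rightarrow> int poly)"
  by unfold_locales (simp_all add: smult_add_right smult_add_left)

definition alexander_lattice :: "nat \<Rightarrow> 'a quiver \<Rightarrow> 'a list \<Rightarrow> int poly set" where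
  "alexander_lattice k Q l =
     Modules.module.span (smult :: int \<Rightarrow> int poly \<Rightarrow> int poly)
       (minors k (parametrized_companion Q l))"

end

theory Submission
  imports Defs
begin

text \<open>
  The span of the \<open>k \<times> k\<close> minors does not change under multiplication by invertible integer
  matrices, so it suffices to find integral congruences \<open>G U G\<^sup>T = U'\<close> between unipotent
  companions: they carry \<open>t U - U\<^sup>T\<close> to \<open>t U' - U'\<^sup>T\<close>. Read \<open>U\<close> as a bilinear form with basis the
  vertices. For a linear ordering \<open>j, xs, ys\<close>, substituting \<open>e\<^sub>x - U\<^sub>j\<^sub>x e\<^sub>j\<close> for
  \<open>e\<^sub>x\<close> (\<open>x \<in> xs\<close>) kills the entries \<open>U\<^sub>j\<^sub>x\<close> and gives an upper triangular form for the
  ordering \<open>xs, j, ys\<close>. If \<open>ys\<close> is empty this realises a rotation of the linear ordering. If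
  \<open>Out(j) \<subseteq> xs\<close> and \<open>In(j) \<subseteq> ys\<close>, then after also negating \<open>e\<^sub>j\<close> it is the proper mutation at \<open>j\<close>.
\<close>

section \<open>Lattices of generalized minors and their behaviour under row operations\<close>

interpretation zspan: Modules.module "smult :: int \<Rightarrow> int poly \<Rightarrow> int poly"
  by (rule module_smult)

text \<open>
  The index maps \<open>f\<close> and \<open>g\<close> need not be increasing or injective. The additional minors are zero or,
  up to sign, ordinary ones, so the span is the same, but multilinear expansion stays inside this
  family and no ordering of the index set is needed.
\<close>

definition minor_of :: "nat \<Rightarrow> ('b \<Rightarrow> 'b \<Rightarrow> int poly) \<Rightarrow> (nat \<Rightarrow> 'b) \<Rightarrow> (nat \<Rightarrow> 'b) \<Rightarrow> int poly"
  where "minor_of k p f g = det (mat k k (\<lambda>(i, j). p (f i) (g j)))"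

definition minor_lattice :: "nat \<Rightarrow> 'b set \<Rightarrow> ('b \<Rightarrow> 'b \<Rightarrow> int poly) \<Rightarrow> int poly set"
  where "minor_lattice k V p =
    zspan.span {minor_of k p f g |f g. f ` {..<k} \<subseteq> V \<and> g ` {..<k} \<subseteq> V}"

lemma minor_of_transpose: "minor_of k (\<lambda>a b. p b a) f g = minor_of k p g f"
proof -
  have "mat k k (\<lambda>(i, j). p (g j) (f i)) = transpose_mat (mat k k (\<lambda>(i, j). p (g i) (f j)))"
    by (rule eq_matI) auto
  then show ?thesis
    unfolding minor_of_def using det_transpose[of "mat k k (\<lambda>(i, j). p (g i) (f j))" k] by simp
qed

lemma minor_lattice_transpose: "minor_lattice k V (\<lambda>a b. p b a) = minor_lattice k V p"
proof -
  have "{minor_of k p g f |f g. f ` {..<k} \<subseteq> V \<and> g ` {..<k} \<subseteq> V} =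
        {minor_of k p f g |f g. f ` {..<k} \<subseteq> V \<and> g ` {..<k} \<subseteq> V}"
    by blast
  then show ?thesis
    unfolding minor_lattice_def minor_of_transpose[of k p] by simp
qed

text \<open>The determinant is multilinear in its rows, so a minor of \<open>p'\<close> expands into
  integer multiples of determinants whose rows are rows of \<open>p\<close>, possibly repeated;
  these belong to the family. \<open>G\<close> may be any integer matrix, so only an inclusion
  results.\<close>

lemma minor_lattice_row_operation:
  assumes "finite V"
    and p': "\<And>a b. a \<in> V \<Longrightarrow> b \<in> V \<Longrightarrow> p' a b = (\<Sum>c\<in>V. of_int (G a c) * p c b)"
  shows "minor_lattice k V p' \<subseteq> minor_lattice k V p"
  unfolding minor_lattice_def[of k V p']
proof (rule zspan.span_minimal)
  show "zspan.subspace (minor_lattice k V p)"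
    unfolding minor_lattice_def by (rule zspan.subspace_span)
  show "{minor_of k p' f g |f g. f ` {..<k} \<subseteq> V \<and> g ` {..<k} \<subseteq> V} \<subseteq> minor_lattice k V p"
  proof clarify
    fix f g assume f: "f ` {..<k} \<subseteq> V" and g: "g ` {..<k} \<subseteq> V"
    \<comment> \<open>In the multilinear expansion below the choice functions \<open>h\<close> are
      the identity off \<open>{0..<k}\<close>, so the summation index must be a natural number;
      \<open>e\<close> enumerates \<open>V\<close> for this.\<close>
    obtain e where e: "bij_betw e {0..<card V} V"
      using ex_bij_betw_nat_finite[OF assms(1)] by blast
    define w where "w c = vec k (\<lambda>j. p (e c) (g j))" for c
    define a where "a i c = of_int (G (f i) (e c)) \<cdot>\<^sub>v w c" for i c
    have w: "w c \<in> carrier_vec k" for c by (simp add: w_def)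
    then have a: "a i c \<in> carrier_vec k" for i c by (simp add: a_def)
    have "mat k k (\<lambda>(i, j). p' (f i) (g j)) =
        mat\<^sub>r k k (\<lambda>i. finsum_vec TYPE(int poly) k (a i) {0..<card V})"
    proof (rule eq_matI)
      fix i j assume "i < dim_row (mat\<^sub>r k k (\<lambda>i. finsum_vec TYPE(int poly) k (a i) {0..<card V}))"
        and "j < dim_col (mat\<^sub>r k k (\<lambda>i. finsum_vec TYPE(int poly) k (a i) {0..<card V}))"
      then have ij: "i < k" "j < k" by simp_all
      then have "f i \<in> V" "g j \<in> V" using f g by auto
      moreover have "finsum_vec TYPE(int poly) k (a i) {0..<card V} $ j = (\<Sum>c\<in>{0..<card V}. a i c $ j)"
        using ij a by (intro index_finsum_vec) auto
      moreover have "(\<Sum>c\<in>V. of_int (G (f i) c) * p c (g j)) = (\<Sum>c\<in>{0..<card V}. a i c $ j)"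
        unfolding sum.reindex_bij_betw[OF e, symmetric] using ij by (simp add: a_def w_def)
      ultimately show "mat k k (\<lambda>(i, j). p' (f i) (g j)) $$ (i, j) =
          mat\<^sub>r k k (\<lambda>i. finsum_vec TYPE(int poly) k (a i) {0..<card V}) $$ (i, j)"
        using ij by (simp add: p')
    qed auto
    then have "minor_of k p' f g = (\<Sum>h\<in>{h. (\<forall>i\<in>{0..<k}. h i \<in> {0..<card V}) \<and> (\<forall>i. i \<notin> {0..<k} \<longrightarrow> h i = i)}.
        det (mat\<^sub>r k k (\<lambda>i. a i (h i))))"
      (is "_ = sum _ ?H")
      unfolding minor_of_def using det_linear_rows_sum[of "{0..<card V}" a k] a by simp
    also have "\<dots> \<in> minor_lattice k V p"
      unfolding minor_lattice_def
    proof (rule zspan.span_sum)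
      fix h assume h: "h \<in> ?H"
      \<comment> \<open>The choice \<open>h\<close> picks one summand in each row;
        \<open>e \<circ> h\<close> becomes the new row index map, and the coefficients come out as
        one integer factor.\<close>
      have "det (mat\<^sub>r k k (\<lambda>i. a i (h i))) =
          (\<Prod>i\<in>{0..<k}. of_int (G (f i) (e (h i)))) * det (mat\<^sub>r k k (\<lambda>i. w (h i)))"
        unfolding a_def using w by (intro det_rows_mul) auto
      also have "mat\<^sub>r k k (\<lambda>i. w (h i)) = mat k k (\<lambda>(i, j). p ((e \<circ> h) i) (g j))"
        by (rule eq_matI) (auto simp: w_def)
      also have "(\<Prod>i\<in>{0..<k}. of_int (G (f i) (e (h i)))) * det \<dots> =
          smult (\<Prod>i\<in>{0..<k}. G (f i) (e (h i))) (minor_of k p (e \<circ> h) g)"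
        unfolding minor_of_def of_int_prod[symmetric] by (simp add: of_int_poly)
      finally have expand: "det (mat\<^sub>r k k (\<lambda>i. a i (h i))) =
          smult (\<Prod>i\<in>{0..<k}. G (f i) (e (h i))) (minor_of k p (e \<circ> h) g)" .
      show "det (mat\<^sub>r k k (\<lambda>i. a i (h i)))
          \<in> zspan.span {minor_of k p f g |f g. f ` {..<k} \<subseteq> V \<and> g ` {..<k} \<subseteq> V}"
        using h g bij_betwE[OF e]
        unfolding expand
        by (intro zspan.span_scale[OF zspan.span_base] CollectI
            exI[of _ "e \<circ> h"] exI[of _ g]) auto
    qed
    finally show "minor_of k p' f g \<in> minor_lattice k V p" .
  qed
qed

lemma minor_lattice_cong:
  assumes "\<And>a b. a \<in> V \<Longrightarrow> b \<in> V \<Longrightarrow> p' a b = p a b"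
  shows "minor_lattice k V p' = minor_lattice k V p"
proof -
  have "minor_of k p' f g = minor_of k p f g"
    if "f ` {..<k} \<subseteq> V" "g ` {..<k} \<subseteq> V" for f g
    unfolding minor_of_def using that assms
    by (intro arg_cong[where f = det] eq_matI) auto
  then show ?thesis
    unfolding minor_lattice_def by (metis (no_types, lifting))
qed

text \<open>The basis change \<open>e_a + r a e_j\<close> for \<open>e_a\<close> and
  \<open>\<epsilon> e_j\<close> for \<open>e_j\<close>, in the first argument only. All rows receive
  multiples of the unscaled row \<open>j\<close>.\<close>

definition row_shear ::
  "'b \<Rightarrow> int \<Rightarrow> ('b \<Rightarrow> int) \<Rightarrow> ('b \<Rightarrow> 'b \<Rightarrow> int poly) \<Rightarrow> 'b \<Rightarrow> 'b \<Rightarrow> int poly" where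
  "row_shear j \<epsilon> r p = (\<lambda>a b. if a = j then of_int \<epsilon> * p j b else p a b + of_int (r a) * p j b)"

lemma minor_lattice_row_shear_subset:
  assumes "finite V" "j \<in> V"
  shows "minor_lattice k V (row_shear j \<epsilon> r p) \<subseteq> minor_lattice k V p"
proof (rule minor_lattice_row_operation[OF assms(1)])
  define G where "G a c =
    (if a = j then (if c = j then \<epsilon> else 0) else (if c = a then 1 else 0) + (if c = j then r a else 0))"
    for a c
  have if_mult: "of_int (if P then x else 0) * z = (if P then of_int x * z else 0)"
    for P x and z :: "int poly" by simp
  fix a b assume "a \<in> V" "b \<in> V"
  then show "row_shear j \<epsilon> r p a b = (\<Sum>c\<in>V. of_int (G a c) * p c b)"
    using assms by (cases "a = j")
      (simp_all add: row_shear_def G_def distrib_right sum.distrib if_mult)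
qed

text \<open>As \<open>\<epsilon>\<close> is its own inverse, a row shear is undone by another one,
  and the inclusion applies both ways. The inverse coefficients carry a factor
  \<open>\<epsilon>\<close> because row \<open>j\<close> has been scaled by then.\<close>

lemma minor_lattice_row_shear:
  assumes "finite V" "j \<in> V" "\<epsilon> * \<epsilon> = 1"
  shows "minor_lattice k V (row_shear j \<epsilon> r p) = minor_lattice k V p"
proof
  have "of_int \<epsilon> * (of_int \<epsilon> * x) = x" for x :: "int poly"
    using assms(3) by (metis mult.assoc mult_1 of_int_1 of_int_mult)
  then have "row_shear j \<epsilon> (\<lambda>a. - (r a * \<epsilon>)) (row_shear j \<epsilon> r p) = p"
    by (auto simp: row_shear_def fun_eq_iff mult.assoc)
  then show "minor_lattice k V p \<subseteq> minor_lattice k V (row_shear j \<epsilon> r p)"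
    using minor_lattice_row_shear_subset[OF assms(1,2), of k \<epsilon> "\<lambda>a. - (r a * \<epsilon>)" "row_shear j \<epsilon> r p"]
    by simp
qed (rule minor_lattice_row_shear_subset[OF assms(1,2)])

text \<open>The congruence by the matrix of \<open>row_shear\<close>: the inner shear acts on the
  transpose, hence on columns, and the outer one on rows.\<close>

definition shear ::
  "'b \<Rightarrow> int \<Rightarrow> ('b \<Rightarrow> int) \<Rightarrow> ('b \<Rightarrow> 'b \<Rightarrow> int poly) \<Rightarrow> 'b \<Rightarrow> 'b \<Rightarrow> int poly" where
  "shear j \<epsilon> r p = row_shear j \<epsilon> r (\<lambda>a b. row_shear j \<epsilon> r (\<lambda>a b. p b a) b a)"

lemma minor_lattice_shear:
  assumes "finite V" "j \<in> V" "\<epsilon> * \<epsilon> = 1"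
  shows "minor_lattice k V (shear j \<epsilon> r p) = minor_lattice k V p"
  unfolding shear_def minor_lattice_row_shear[OF assms]
  using minor_lattice_transpose[of k V "row_shear j \<epsilon> r (\<lambda>a b. p b a)"]
    minor_lattice_row_shear[OF assms, of k r "\<lambda>a b. p b a"] minor_lattice_transpose[of k V p]
  by simp

section \<open>Comparison with the minors of submatrices, and transfer to vertices\<close>

lemma submatrix_eq_mat_pick:
  assumes "I \<subseteq> {..<dim_row A}" "J \<subseteq> {..<dim_col A}" "card I = k" "card J = k"
  shows "submatrix A I J = mat k k (\<lambda>(i, j). A $$ (pick I i, pick J j))"
proof -
  have "{i. i < dim_row A \<and> i \<in> I} = I" "{j. j < dim_col A \<and> j \<in> J} = J"
    using assms by auto
  then show ?thesis using assms by (simp add: submatrix_def)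
qed

text \<open>An injective index map is the increasing enumeration of its image after a permutation;
  this is what reduces generalized minors to ordinary ones.\<close>

lemma exists_permutation_to_pick:
  fixes f :: "nat \<Rightarrow> nat"
  assumes "inj_on f {..<k}"
  obtains \<pi> where "\<pi> permutes {0..<k}" "\<And>i. i < k \<Longrightarrow> f i = pick (f ` {..<k}) (\<pi> i)"
proof -
  let ?I = "f ` {..<k}"
  have card: "card ?I = k" using assms by (simp add: card_image)
  \<comment> \<open>\<open>\<pi> i\<close> is the rank of \<open>f i\<close> in the image, counted
    from 0, extended by the identity as \<open>permutes\<close> demands.\<close>
  define \<pi> where "\<pi> i = (if i < k then card {a \<in> ?I. a < f i} else i)" for i
  have pick: "f i = pick ?I (\<pi> i)" if "i < k" for i
    using that by (simp add: \<pi>_def pick_card_in_set)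
  have "\<pi> i < k" if "i < k" for i
  proof -
    have "{a \<in> ?I. a < f i} \<subset> ?I" using that by auto
    then have "card {a \<in> ?I. a < f i} < card ?I" by (intro psubset_card_mono) auto
    then show ?thesis using that card by (simp add: \<pi>_def)
  qed
  moreover have "inj_on \<pi> {0..<k}"
    by (rule inj_onI) (metis atLeastLessThan_iff pick assms inj_onD lessThan_iff)
  ultimately have "bij_betw \<pi> {0..<k} {0..<k}"
    by (simp add: bij_betw_def endo_inj_surj image_subset_iff)
  then have "\<pi> permutes {0..<k}"
    by (rule bij_imp_permutes) (simp add: \<pi>_def)
  then show thesis using that pick by blast
qed

lemma minor_of_not_inj:
  assumes "\<not> inj_on f {..<k}"
  shows "minor_of k p f g = 0"
proof -
  obtain i j where ij: "i < k" "j < k" "i \<noteq> j" "f i = f j"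
    using assms by (auto simp: inj_on_def)
  show ?thesis
    unfolding minor_of_def by (rule det_identical_rows[OF _ ij(3,1,2)]) (use ij in auto)
qed

lemma minor_of_permute_rows:
  assumes "\<pi> permutes {0..<k}" "\<And>i. i < k \<Longrightarrow> f i = f' (\<pi> i)"
  shows "minor_of k p f g = signof \<pi> * minor_of k p f' g"
proof -
  have "\<pi> i < k" if "i < k" for i
    using permutes_in_image[OF assms(1)] that by simp
  then have "mat k k (\<lambda>(i, j). p (f i) (g j)) =
      mat k k (\<lambda>(i, j). mat k k (\<lambda>(i, j). p (f' i) (g j)) $$ (\<pi> i, j))"
    using assms(2) by (intro eq_matI) auto
  then show ?thesis
    unfolding minor_of_def using det_permute_rows[of "mat k k (\<lambda>(i, j). p (f' i) (g j))", OF _ assms(1)] by simp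
qed

text \<open>A repeated row gives 0 and sorting the rows costs only a sign. Since \<open>p\<close>
  and \<open>g\<close> are arbitrary, the same reduction sorts columns after transposition.\<close>

lemma minor_of_in_span_increasing:
  fixes f g :: "nat \<Rightarrow> nat"
  assumes "\<And>I. I \<subseteq> f ` {..<k} \<Longrightarrow> card I = k \<Longrightarrow> minor_of k p (pick I) g \<in> zspan.span S"
  shows "minor_of k p f g \<in> zspan.span S"
proof (cases "inj_on f {..<k}")
  case True
  then obtain \<pi> where \<pi>: "\<pi> permutes {0..<k}" "\<And>i. i < k \<Longrightarrow> f i = pick (f ` {..<k}) (\<pi> i)"
    using exists_permutation_to_pick[OF True] by blast
  have "minor_of k p (pick (f ` {..<k})) g \<in> zspan.span S"
    using True by (intro assms) (auto simp: card_image)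
  then show ?thesis
    using minor_of_permute_rows[where f' = "pick (f ` {..<k})", OF \<pi>, of p g]
    by (cases "evenperm \<pi>") (simp_all add: sign_def zspan.span_neg)
qed (simp add: minor_of_not_inj zspan.span_zero)

lemma span_minors_eq_minor_lattice:
  assumes "A \<in> carrier_mat n n"
  shows "zspan.span (minors k A) = minor_lattice k {..<n} (\<lambda>i j. A $$ (i, j))"
    (is "_ = minor_lattice k _ ?p")
proof
  have minor: "det (submatrix A I J) = minor_of k ?p (pick I) (pick J)"
    if "I \<subseteq> {..<n}" "J \<subseteq> {..<n}" "card I = k" "card J = k" for I J
    using assms that by (simp add: minor_of_def submatrix_eq_mat_pick)
  have "pick I ` {..<k} \<subseteq> {..<n}" if "I \<subseteq> {..<n}" "card I = k" for I
    using pick_in_set_le[of _ I] that by blast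
  then show "zspan.span (minors k A) \<subseteq> minor_lattice k {..<n} ?p"
    unfolding minor_lattice_def minors_def using assms minor
    by (intro zspan.span_mono subsetI) (simp, metis)
  have "minor_of k ?p f g \<in> zspan.span (minors k A)"
    if f: "f ` {..<k} \<subseteq> {..<n}" and g: "g ` {..<k} \<subseteq> {..<n}" for f g
  proof (rule minor_of_in_span_increasing)
    fix I assume I: "I \<subseteq> f ` {..<k}" "card I = k"
    \<comment> \<open>The rows are now increasing; transposing lets the same lemma sort the
      columns.\<close>
    have "minor_of k (\<lambda>a b. ?p b a) g (pick I) \<in> zspan.span (minors k A)"
    proof (rule minor_of_in_span_increasing)
      fix J assume J: "J \<subseteq> g ` {..<k}" "card J = k"
      have IJ: "I \<subseteq> {..<n}" "J \<subseteq> {..<n}" "card I = k" "card J = k"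
        using I J f g by auto
      have "minor_of k ?p (pick I) (pick J) \<in> minors k A"
        unfolding minors_def using assms IJ
        by (intro CollectI exI[of _ I] exI[of _ J]) (simp add: minor)
      then show "minor_of k (\<lambda>a b. ?p b a) (pick J) (pick I) \<in> zspan.span (minors k A)"
        by (simp add: minor_of_transpose[of k ?p] zspan.span_base)
    qed
    then show "minor_of k ?p (pick I) g \<in> zspan.span (minors k A)"
      by (simp add: minor_of_transpose[of k ?p])
  qed
  then show "minor_lattice k {..<n} ?p \<subseteq> zspan.span (minors k A)"
    unfolding minor_lattice_def
    by (intro zspan.span_minimal zspan.subspace_span) blast
qed

text \<open>Used to pass from list positions to vertices, so that all orderings of the same vertices
  share one index set.\<close>

lemma minor_lattice_reindex:
  assumes "bij_betw h U V"
  shows "minor_lattice k U (\<lambda>a b. p (h a) (h b)) = minor_lattice k V p"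
proof -
  let ?q = "\<lambda>a b. p (h a) (h b)"
  let ?h' = "inv_into U h"
  have h: "h a \<in> V" if "a \<in> U" for a using assms that by (auto simp: bij_betw_def)
  have h': "?h' a \<in> U" "h (?h' a) = a" if "a \<in> V" for a
    using assms that by (auto simp: bij_betw_def inv_into_into f_inv_into_f)
  have 1: "minor_of k ?q f g = minor_of k p (h \<circ> f) (h \<circ> g)" for f g
    by (simp add: minor_of_def)
  have 2: "minor_of k p f g = minor_of k ?q (?h' \<circ> f) (?h' \<circ> g)"
    if "f ` {..<k} \<subseteq> V" "g ` {..<k} \<subseteq> V" for f g
    unfolding minor_of_def using that h'
    by (intro arg_cong[where f = det] eq_matI) (auto simp: image_subset_iff)
  have "{minor_of k ?q f g |f g. f ` {..<k} \<subseteq> U \<and> g ` {..<k} \<subseteq> U} =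
      {minor_of k p f g |f g. f ` {..<k} \<subseteq> V \<and> g ` {..<k} \<subseteq> V}" (is "?L = ?R")
  proof (intro equalityI subsetI)
    fix x assume "x \<in> ?L"
    then obtain f g where "x = minor_of k ?q f g" "f ` {..<k} \<subseteq> U" "g ` {..<k} \<subseteq> U" by blast
    then have "x = minor_of k p (h \<circ> f) (h \<circ> g)" "(h \<circ> f) ` {..<k} \<subseteq> V" "(h \<circ> g) ` {..<k} \<subseteq> V"
      using h 1 by (auto simp: image_subset_iff)
    then show "x \<in> ?R" by blast
  next
    fix x assume "x \<in> ?R"
    then obtain f g where x: "x = minor_of k p f g" "f ` {..<k} \<subseteq> V" "g ` {..<k} \<subseteq> V" by blast
    then have "x = minor_of k ?q (?h' \<circ> f) (?h' \<circ> g)"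
      "(?h' \<circ> f) ` {..<k} \<subseteq> U" "(?h' \<circ> g) ` {..<k} \<subseteq> U"
      using h' x(2,3) 2[OF x(2,3)] by (auto simp: image_subset_iff)
    then show "x \<in> ?L" by blast
  qed
  then show ?thesis unfolding minor_lattice_def by simp
qed

section \<open>The parametrized companion as a form on the vertices\<close>

text \<open>Comparing vertices instead of positions lets the order split along \<open>@\<close>, so
  moving a vertex needs no index arithmetic.\<close>

primrec before :: "'b list \<Rightarrow> 'b \<Rightarrow> 'b \<Rightarrow> bool" where
  "before [] a b \<longleftrightarrow> False"
| "before (x # xs) a b \<longleftrightarrow> a = x \<and> b \<in> set xs \<or> before xs a b"

lemma before_in_set: "before l a b \<Longrightarrow> a \<in> set l \<and> b \<in> set l"
  by (induction l) auto

lemma before_append: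
  "before (xs @ ys) a b \<longleftrightarrow> before xs a b \<or> before ys a b \<or> a \<in> set xs \<and> b \<in> set ys"
  by (induction xs) auto

lemma before_nth:
  "distinct l \<Longrightarrow> i < length l \<Longrightarrow> j < length l \<Longrightarrow> before l (l ! i) (l ! j) \<longleftrightarrow> i < j"
proof (induction l arbitrary: i j)
  case (Cons x xs)
  then show ?case
    by (cases i; cases j) (auto dest: before_in_set)
qed simp

definition exchange :: "'b quiver \<Rightarrow> 'b \<Rightarrow> 'b \<Rightarrow> int" where
  "exchange Q a b = int (arrows Q a b) - int (arrows Q b a)"

text \<open>The unipotent companion as a bilinear form on vertices. Taking any function
  \<open>b\<close> in place of a quiver lets the move of \<open>j\<close> be treated before mutation
  enters.\<close>

definition companion :: "'b list \<Rightarrow> ('b \<Rightarrow> 'b \<Rightarrow> int) \<Rightarrow> 'b \<Rightarrow> 'b \<Rightarrow> int" where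
  "companion l b x y = (if x = y then 1 else if before l x y then - b x y else 0)"

definition pencil :: "'b list \<Rightarrow> ('b \<Rightarrow> 'b \<Rightarrow> int) \<Rightarrow> 'b \<Rightarrow> 'b \<Rightarrow> int poly" where
  "pencil l b x y = [:0, 1:] * of_int (companion l b x y) - of_int (companion l b y x)"

lemma parametrized_companion_eq:
  assumes "distinct l"
  shows "parametrized_companion Q l =
    mat (length l) (length l) (\<lambda>(i, j). pencil l (exchange Q) (l ! i) (l ! j))"
proof -
  let ?n = "length l"
  have "is_unipotent_companion (exchange_matrix Q l) (unipotent_companion Q l)"
    unfolding unipotent_companion_def by (rule theI'[OF unipotent_companion_unique])
  then have "unipotent_companion Q l = mat ?n ?n (\<lambda>(i, j). companion l (exchange Q) (l ! i) (l ! j))"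
    using assms unfolding is_unipotent_companion_iff
    by (auto simp: companion_def before_nth exchange_matrix_def exchange_def nth_eq_iff_index_eq
        intro!: eq_matI)
  then show ?thesis
    by (auto simp: parametrized_companion_def pencil_def Let_def of_int_poly intro!: eq_matI)
qed

lemma alexander_lattice_eq_minor_lattice:
  assumes "distinct l"
  shows "alexander_lattice k Q l = minor_lattice k (set l) (pencil l (exchange Q))"
proof -
  let ?n = "length l"
  let ?p = "pencil l (exchange Q)"
  have "alexander_lattice k Q l =
      minor_lattice k {..<?n} (\<lambda>i j. parametrized_companion Q l $$ (i, j))"
    unfolding alexander_lattice_def
    by (rule span_minors_eq_minor_lattice) (simp add: parametrized_companion_eq[OF assms])
  also have "\<dots> = minor_lattice k {..<?n} (\<lambda>i j. ?p (l ! i) (l ! j))"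
    by (rule minor_lattice_cong) (simp add: parametrized_companion_eq[OF assms])
  also have "\<dots> = minor_lattice k (set l) ?p"
    using assms by (intro minor_lattice_reindex bij_betw_nth) auto
  finally show ?thesis .
qed

section \<open>Moving the first vertex by an integral congruence\<close>

text \<open>
  The sign \<open>\<epsilon>\<close> is \<open>1\<close> for rotations and \<open>-1\<close> for proper mutations.
\<close>

lemma minor_lattice_pencil_move:
  assumes dist: "distinct (j # xs @ ys)" and \<epsilon>: "\<epsilon> * \<epsilon> = 1"
    and skew: "\<And>a c. b c a = - b a c"
    and xx: "\<And>x x'. x \<in> set xs \<Longrightarrow> x' \<in> set xs \<Longrightarrow> b' x x' = b x x'"
    and yy: "\<And>y y'. y \<in> set ys \<Longrightarrow> y' \<in> set ys \<Longrightarrow> b' y y' = b y y'"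
    and xy: "\<And>x y. x \<in> set xs \<Longrightarrow> y \<in> set ys \<Longrightarrow> b' x y = b x y + b j x * b j y"
    and xj: "\<And>x. x \<in> set xs \<Longrightarrow> b' x j = \<epsilon> * b x j"
    and jy: "\<And>y. y \<in> set ys \<Longrightarrow> b' j y = \<epsilon> * b j y"
  shows "minor_lattice k (set (j # xs @ ys)) (pencil (xs @ j # ys) b') =
    minor_lattice k (set (j # xs @ ys)) (pencil (j # xs @ ys) b)"
proof -
  let ?l = "j # xs @ ys" and ?l' = "xs @ j # ys"
  \<comment> \<open>Above the diagonal the companion is \<open>- b\<close>, so subtracting the entry
    at \<open>(j, x)\<close> means adding \<open>b j x\<close> times \<open>e_j\<close>.\<close>
  define r where "r a = (if a \<in> set xs then b j a else 0)" for a
  have e: "of_int \<epsilon> * of_int \<epsilon> = (1 :: int poly)"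
    using \<epsilon> by (metis of_int_1 of_int_mult)
  then have e': "of_int \<epsilon> * (of_int \<epsilon> * x) = x" for x :: "int poly"
    by (metis mult.assoc mult_1)
  have nb: "\<not> before zs a c" if "a \<notin> set zs \<or> c \<notin> set zs" for a c and zs :: "'b list"
    using that before_in_set by fastforce
  have x: "x \<noteq> j" "x \<notin> set ys" if "x \<in> set xs" for x using dist that by auto
  have y: "y \<noteq> j" "y \<notin> set xs" if "y \<in> set ys" for y using dist that by auto
  have j: "j \<notin> set xs" "j \<notin> set ys" using dist by auto
  let ?u = "companion ?l b" and ?u' = "companion ?l' b'"
  have jj: "?u j j = 1" "?u' j j = 1" by (simp_all add: companion_def)
  have u_j: "?u j x = - b j x" "?u x j = 0" "?u' x j = \<epsilon> * b j x" "?u' j x = 0" if "x \<in> set xs" for x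
    using x[OF that] j that skew[of x j] xj[OF that]
    by (auto simp: companion_def before_append nb)
  have u_j': "?u j y = - b j y" "?u y j = 0" "?u' j y = - (\<epsilon> * b j y)" "?u' y j = 0" if "y \<in> set ys" for y
    using y[OF that] j that jy[OF that] by (auto simp: companion_def before_append nb)
  have u_xy: "?u x y = - b x y" "?u y x = 0" "?u' x y = - (b x y + b j x * b j y)" "?u' y x = 0"
    if "x \<in> set xs" "y \<in> set ys" for x y
    using x[OF that(1)] y[OF that(2)] j that xy[OF that] by (auto simp: companion_def before_append nb)
  have u_xx: "?u' x x' = ?u x x'" if "x \<in> set xs" "x' \<in> set xs" for x x'
    using x[OF that(1)] x[OF that(2)] that xx by (simp add: companion_def before_append nb)
  have u_yy: "?u' y y' = ?u y y'" if "y \<in> set ys" "y' \<in> set ys" for y y'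
    using y[OF that(1)] y[OF that(2)] that yy by (simp add: companion_def before_append nb)
  have "minor_lattice k (set ?l) (pencil ?l' b') =
      minor_lattice k (set ?l) (shear j \<epsilon> r (pencil ?l b))"
  proof (rule minor_lattice_cong)
    fix a c assume "a \<in> set ?l" "c \<in> set ?l"
    \<comment> \<open>Between two vertices of \<open>xs\<close> the corrections
      \<open>- b j x * b j x'\<close>, from \<open>?u j x'\<close>, and
      \<open>+ b j x * b j x'\<close>, from \<open>?u j j = 1\<close>, cancel. From
      \<open>xs\<close> to \<open>ys\<close> the term \<open>- b j x * b j y\<close> survives and
      matches \<open>xy\<close>.\<close>
    then consider "a = j" "c = j" | "a = j" "c \<in> set xs" | "a = j" "c \<in> set ys"
      | "a \<in> set xs" "c = j" | "a \<in> set xs" "c \<in> set xs" | "a \<in> set xs" "c \<in> set ys"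
      | "a \<in> set ys" "c = j" | "a \<in> set ys" "c \<in> set xs" | "a \<in> set ys" "c \<in> set ys"
      by auto
    then show "pencil ?l' b' a c = shear j \<epsilon> r (pencil ?l b) a c"
      by cases (simp_all add: shear_def row_shear_def r_def pencil_def jj u_j u_j' u_xy u_xx u_yy x y j e e' one_pCons algebra_simps)
  qed
  also have "\<dots> = minor_lattice k (set ?l) (pencil ?l b)"
    using \<epsilon> by (intro minor_lattice_shear) auto
  finally show ?thesis .
qed

section \<open>Rotations, wiggles and proper mutations\<close>

lemma exchange_skew: "exchange Q c a = - exchange Q a c"
  by (simp add: exchange_def)

text \<open>With \<open>ys\<close> empty the mixed condition of the move is vacuous, so the same
  exchange function serves before and after.\<close>

lemma alexander_lattice_rotate1:
  assumes "distinct l"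
  shows "alexander_lattice k Q (rotate1 l) = alexander_lattice k Q l"
proof (cases l)
  case (Cons j xs)
  then show ?thesis
    using minor_lattice_pencil_move[where ys = "[]" and \<epsilon> = 1 and b' = "exchange Q",
        OF _ _ exchange_skew, of j xs Q] assms
    by (simp add: alexander_lattice_eq_minor_lattice)
qed simp

lemma alexander_lattice_cyclic_class:
  assumes "distinct l" "l' \<in> cyclic_class l"
  shows "alexander_lattice k Q l' = alexander_lattice k Q l"
proof -
  have "alexander_lattice k Q (rotate m l) = alexander_lattice k Q l" for m
    using assms(1) by (induction m) (simp_all add: alexander_lattice_rotate1)
  then show ?thesis using assms(2) by (auto simp: cyclic_class_def)
qed

text \<open>Only the entries between \<open>a\<close> and \<open>b\<close> depend on their relative
  order, and these vanish, so the two pencils are equal.\<close>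

lemma alexander_lattice_swap:
  assumes "distinct (a # b # xs)" "arrows Q a b = 0" "arrows Q b a = 0"
  shows "alexander_lattice k Q (b # a # xs) = alexander_lattice k Q (a # b # xs)"
proof -
  have "pencil (b # a # xs) (exchange Q) = pencil (a # b # xs) (exchange Q)"
    using assms by (auto simp: fun_eq_iff pencil_def companion_def exchange_def)
  then show ?thesis
    using assms(1) by (auto simp: alexander_lattice_eq_minor_lattice insert_commute)
qed

text \<open>All two-arrow paths through \<open>j\<close> run from \<open>ys\<close> to
  \<open>xs\<close>. Away from \<open>j\<close>, mutation thus changes only the entries between
  \<open>xs\<close> and \<open>ys\<close>, by the product required in the move; at \<open>j\<close>
  it flips signs, whence \<open>\<epsilon> = -1\<close>.\<close>

lemma alexander_lattice_mutate:
  assumes "wf_quiver Q" "distinct (j # xs @ ys)" "set (j # xs @ ys) = verts Q"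
    and out: "Out_set Q j \<subseteq> set xs" and in_set: "In_set Q j \<inter> set xs = {}"
  shows "alexander_lattice k (mutate j Q) (xs @ j # ys) = alexander_lattice k Q (j # xs @ ys)"
proof -
  have x: "arrows Q x j = 0" if "x \<in> set xs" for x
    using in_set that by (auto simp: In_set_def)
  have y: "arrows Q j y = 0" if "y \<in> set ys" for y
    using out assms(2) that by (auto simp: Out_set_def)
  have jn: "j \<notin> set xs" "j \<notin> set ys" using assms(2) by auto
  \<comment> \<open>Cancelling 2-cycles by truncated subtraction preserves the signed arrow
    count.\<close>
  have int_diff: "int (m - n) - int (n - m) = int m - int n" for m n by simp
  have two: "arrows Q a c = 0 \<or> arrows Q c a = 0" "arrows Q a a = 0" for a c
    using assms(1) by (auto simp: wf_quiver_def)
  note defs = exchange_def mutate_def cancel_two_cycles_def reverse_arrows_at_def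
    compose_paths_at_def
  have "minor_lattice k (set (j # xs @ ys)) (pencil (xs @ j # ys) (exchange (mutate j Q))) =
      minor_lattice k (set (j # xs @ ys)) (pencil (j # xs @ ys) (exchange Q))"
  proof (rule minor_lattice_pencil_move[where \<epsilon> = "-1"])
    fix a c assume ac: "a \<in> set xs" "c \<in> set ys"
    then have "a \<noteq> j" "c \<noteq> j" using jn by auto
    then show "exchange (mutate j Q) a c = exchange Q a c + exchange Q j a * exchange Q j c"
      using x[OF ac(1)] y[OF ac(2)] by (simp add: defs int_diff)
  next
    fix a c assume ac: "a \<in> set xs" "c \<in> set xs"
    then have "a \<noteq> j" "c \<noteq> j" using jn by auto
    then show "exchange (mutate j Q) a c = exchange Q a c"
      using x[OF ac(1)] x[OF ac(2)] by (simp add: defs)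
  next
    fix a c assume ac: "a \<in> set ys" "c \<in> set ys"
    then have "a \<noteq> j" "c \<noteq> j" using jn by auto
    then show "exchange (mutate j Q) a c = exchange Q a c"
      using y[OF ac(1)] y[OF ac(2)] by (simp add: defs)
  next
    fix a assume "a \<in> set xs"
    show "exchange (mutate j Q) a j = - 1 * exchange Q a j"
      using two by (simp add: defs)
  next
    fix a assume "a \<in> set ys"
    show "exchange (mutate j Q) j a = - 1 * exchange Q j a"
      using two by (simp add: defs)
  qed (use assms(2) in \<open>auto simp: exchange_def\<close>)
  then show ?thesis
    using assms(2) by (simp add: alexander_lattice_eq_minor_lattice)
qed

theorem corollary8p8:
  fixes Q Q' :: "'a quiver" and \<sigma> \<sigma>' :: "'a list set" and l l' :: "'a list" and k :: nat
  assumes "wf_coq (Q, \<sigma>)"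
    and "wiggle (Q, \<sigma>) (Q', \<sigma>') \<or> (\<exists>j. proper_mutation j (Q, \<sigma>) (Q', \<sigma>'))"
    and "k \<in> {1..card (verts Q)}"
    and "l \<in> \<sigma>" and "l' \<in> \<sigma>'"
  shows "alexander_lattice k Q l = alexander_lattice k Q' l'"
  using assms(2)
proof (elim disjE exE)
  assume "wiggle (Q, \<sigma>) (Q', \<sigma>')"
  then obtain a b xs where Q': "Q' = Q"
    and \<sigma>: "\<sigma> = cyclic_class (a # b # xs)" "\<sigma>' = cyclic_class (b # a # xs)"
    and ab: "arrows Q a b = 0" "arrows Q b a = 0"
    by (auto simp: wiggle_def)
  have dist: "distinct (a # b # xs)" "distinct (b # a # xs)"
    using assms(1) by (auto simp: \<sigma> wf_coq_cyclic_class)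
  \<comment> \<open>Rotation invariance replaces \<open>l\<close> and \<open>l'\<close> by the
    representatives that exhibit the wiggle.\<close>
  show ?thesis
    using alexander_lattice_swap[OF dist(1) ab] alexander_lattice_cyclic_class[OF dist(1)]
      alexander_lattice_cyclic_class[OF dist(2)] assms(4,5) by (simp add: Q' \<sigma>)
next
  fix j assume "proper_mutation j (Q, \<sigma>) (Q', \<sigma>')"
  then obtain xs ys where Q': "Q' = mutate j Q"
    and \<sigma>: "\<sigma> = cyclic_class (j # xs @ ys)" "\<sigma>' = cyclic_class (xs @ j # ys)"
    and sub: "Out_set Q j \<subseteq> set xs" "In_set Q j \<inter> set xs = {}"
    by (auto simp: proper_mutation_def)
  have wf: "wf_quiver Q" "distinct (j # xs @ ys)" "set (j # xs @ ys) = verts Q"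
    using assms(1) by (auto simp: \<sigma> wf_coq_cyclic_class)
  then have "distinct (xs @ j # ys)" by auto
  from alexander_lattice_cyclic_class[OF this] show ?thesis
    using alexander_lattice_mutate[OF wf sub] alexander_lattice_cyclic_class[OF wf(2)]
      assms(4,5) by (simp add: Q' \<sigma>)
qed

end
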